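(* For $1<R<2$, the following algorithm is $\max\{\frac{1}{R-1},2\}$-competitive for the general\&removable online knapsack problem with a buffer of capacity $R$: starting from $B_0=\emptyset$, in each round $i$ set $B_i=\emptyset$ and go through the items $e\in B_{i-1}\cup\{e_i\}$ in non-increasing order of density $v(e)/s(e)$, adding $e$ to $B_i$ whenever $s(B_i)+s(e)\le R$.
   Context: Online knapsack problem with a resource buffer: there is a knapsack of capacity $1$ and a buffer of capacity $R\ge 1$. Items $e_1,\dots,e_n$ arrive one by one; each item $e$ has size $0<s(e)\le 1$ and value $v(e)\ge 0$; $s(B),v(B)$ denote sums over a set $B$. A deterministic online algorithm maintains buffer contents $B_0=\emptyset,B_1,\dots,B_n$, with $B_i$ chosen after seeing only $e_1,\dots,e_i$, $B_i\subseteq B_{i-1}\cup\{e_i\}$ and $s(B_i)\le R$ (removable setting). $\mathrm{ALG}(I)=\max\{v(B)\mid B\subseteq B_n,\ s(B)\le 1\}$, $\mathrm{OPT}(I)=\max\{v(B)\mid B\subseteq\{e_1,\dots,e_n\},\ s(B)\le 1\}$. "General" means values are arbitrary. An algorithm is $c$-competitive if $\mathrm{OPT}(I)\le c\cdot\mathrm{ALG}(I)$ for every input $I$. Ties are broken arbitrarily. *)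

theory Defs
  imports Complex_Main
begin

datatype item = Item (item_size: real) (item_value: real)

definition density :: "item \<Rightarrow> real" where
  "density e = item_value e / item_size e"

text \<open>
  An input is the list of items in order of arrival. Sets of items are represented by sets of
  positions in that list, so that items of equal size and value remain distinct.
\<close>

definition valid_input :: "item list \<Rightarrow> bool" where
  "valid_input I \<longleftrightarrow> (\<forall>e\<in>set I. 0 < item_size e \<and> item_size e \<le> 1 \<and> 0 \<le> item_value e)"

definition total_size :: "item list \<Rightarrow> nat set \<Rightarrow> real" where
  "total_size I B = (\<Sum>i\<in>B. item_size (I ! i))"

definition total_value :: "item list \<Rightarrow> nat set \<Rightarrow> real" where
  "total_value I B = (\<Sum>i\<in>B. item_value (I ! i))"

definition best_value :: "item list \<Rightarrow> nat set \<Rightarrow> real" where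
  "best_value I S = Max {total_value I B | B. B \<subseteq> S \<and> total_size I B \<le> 1}"

definition OPT :: "item list \<Rightarrow> real" where
  "OPT I = best_value I {..<length I}"

text \<open>
  A deterministic online algorithm maps the sequence of items seen so far to the current buffer
  contents: on the input \<open>I\<close>, the buffer after round \<open>i\<close> is \<open>A (take i I)\<close>.
\<close>

type_synonym algorithm = "item list \<Rightarrow> nat set"

definition removable_online_algorithm :: "real \<Rightarrow> algorithm \<Rightarrow> bool" where
  "removable_online_algorithm R A \<longleftrightarrow>
     A [] = {} \<and>
     (\<forall>I e. valid_input (I @ [e]) \<longrightarrow>
        A (I @ [e]) \<subseteq> insert (length I) (A I) \<and>
        total_size (I @ [e]) (A (I @ [e])) \<le> R)"

definition ALG :: "algorithm \<Rightarrow> item list \<Rightarrow> real" where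
  "ALG A I = best_value I (A I)"

definition competitive :: "real \<Rightarrow> algorithm \<Rightarrow> bool" where
  "competitive c A \<longleftrightarrow> (\<forall>I. valid_input I \<longrightarrow> OPT I \<le> c * ALG A I)"

fun greedy_fill :: "real \<Rightarrow> item list \<Rightarrow> nat list \<Rightarrow> nat set \<Rightarrow> nat set" where
  "greedy_fill R I [] B = B"
| "greedy_fill R I (i # is) B =
     greedy_fill R I is (if total_size I B + item_size (I ! i) \<le> R then insert i B else B)"

text \<open>
  Ties are broken arbitrarily: any enumeration of the candidates in non-increasing order of
  density may be used, independently in each round.
\<close>

definition greedy_outcome :: "real \<Rightarrow> item list \<Rightarrow> nat set \<Rightarrow> nat set \<Rightarrow> bool" where
  "greedy_outcome R I S B \<longleftrightarrow>
     (\<exists>is. distinct is \<and> set is = S \<and>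
           sorted_wrt (\<lambda>i j. density (I ! i) \<ge> density (I ! j)) is \<and>
           B = greedy_fill R I is {})"

definition density_greedy_algorithm :: "real \<Rightarrow> algorithm \<Rightarrow> bool" where
  "density_greedy_algorithm R A \<longleftrightarrow>
     A [] = {} \<and>
     (\<forall>I e. valid_input (I @ [e]) \<longrightarrow>
        greedy_outcome R (I @ [e]) (insert (length I) (A I)) (A (I @ [e])))"

lemma greedy_fill_subset: "greedy_fill R I is B \<subseteq> set is \<union> B"
proof (induction "is" arbitrary: B)
  case (Cons i "is")
  show ?case
    using Cons.IH[of "insert i B"] Cons.IH[of B] by auto
qed simp

lemma density_greedy_algorithm_exists: "\<exists>A. density_greedy_algorithm R A"
proof -
  define cands where "cands I S = sort_key (\<lambda>i. - density (I ! i)) (sorted_list_of_set S)"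
    for I and S :: "nat set"
  define G where "G = rec_list ({} :: nat set) (\<lambda>e es B.
    greedy_fill R (rev es @ [e]) (cands (rev es @ [e]) (insert (length es) B)) {})"
  have G_Nil: "G [] = {}"
    and G_Cons: "G (e # es) = greedy_fill R (rev es @ [e])
      (cands (rev es @ [e]) (insert (length es) (G es))) {}" for e es
    by (simp_all add: G_def)
  have cands: "set (cands I S) = S" "distinct (cands I S)"
    "sorted_wrt (\<lambda>i j. density (I ! i) \<ge> density (I ! j)) (cands I S)" if "finite S" for I S
  proof -
    have "sorted (map (\<lambda>i. - density (I ! i)) (cands I S))"
      unfolding cands_def by simp
    then show "sorted_wrt (\<lambda>i j. density (I ! i) \<ge> density (I ! j)) (cands I S)"
      by (simp add: sorted_map)
  qed (use that in \<open>simp_all add: cands_def\<close>)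
  have fin: "finite (G es)" for es
  proof (induction es)
    case (Cons e es)
    then show ?case
      unfolding G_Cons by (meson List.finite_set finite.emptyI finite_UnI finite_subset greedy_fill_subset)
  qed (simp add: G_Nil)
  have "density_greedy_algorithm R (\<lambda>I. G (rev I))"
    unfolding density_greedy_algorithm_def greedy_outcome_def
  proof (intro conjI allI impI)
    fix I e
    show "\<exists>is. distinct is \<and> set is = insert (length I) (G (rev I)) \<and>
        sorted_wrt (\<lambda>i j. density ((I @ [e]) ! i) \<ge> density ((I @ [e]) ! j)) is \<and>
        G (rev (I @ [e])) = greedy_fill R (I @ [e]) is {}"
      by (rule exI[of _ "cands (I @ [e]) (insert (length I) (G (rev I)))"])
        (simp add: cands fin G_Cons)
  qed (simp add: G_Nil)
  then show ?thesis by blast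
qed

end

theory Submission imports Defs begin

text \<open>
  Once an item of density \<open>d\<close> has been dropped, the buffer forever holds items of density at least
  \<open>d\<close> of total size more than \<open>R - 1\<close>: if a later round drops one of these, then that dropped item
  is itself a witness, since it had size at most 1 and did not fit on top of denser items. Take
  \<open>d\<close> maximal among the dropped items and let \<open>T\<close> be the buffer items of density at least \<open>d\<close>. Every
  item outside \<open>T\<close> has density at most \<open>d\<close>, so the fractional relaxation bounds OPT: if \<open>T\<close> fits
  into the knapsack, then OPT is at most \<open>v(T)/s(T)\<close>, and \<open>s(T) > R - 1\<close>; otherwise OPT is at most
  the value of the densest items of \<open>T\<close> up to and including the first one that overflows the
  knapsack, which splits into two feasible sets.
\<close>

section \<open>Sizes and values of index sets\<close>

definition denser :: "item list \<Rightarrow> real \<Rightarrow> nat set \<Rightarrow> nat set" where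
  "denser I d B = {i \<in> B. d \<le> density (I ! i)}"

lemma valid_input_nth:
  assumes "valid_input I" "i < length I"
  shows "0 < item_size (I ! i)" "item_size (I ! i) \<le> 1" "0 \<le> item_value (I ! i)"
  using assms by (auto simp: valid_input_def)

lemma total_size_mono:
  assumes "valid_input I" "B \<subseteq> C" "C \<subseteq> {..<length I}"
  shows "total_size I B \<le> total_size I C"
  unfolding total_size_def using assms
  by (intro sum_mono2) (auto intro: finite_subset less_imp_le dest: valid_input_nth(1))

lemma total_size_append:
  "B \<subseteq> {..<length I} \<Longrightarrow> total_size (I @ J) B = total_size I B"
  unfolding total_size_def by (intro sum.cong) (auto simp: nth_append)

lemma denser_append:
  "B \<subseteq> {..<length I} \<Longrightarrow> denser (I @ J) d B = denser I d B"
  unfolding denser_def by (auto simp: nth_append)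

lemma finite_feasible_values:
  "finite S \<Longrightarrow> finite {total_value I B | B. B \<subseteq> S \<and> total_size I B \<le> 1}"
  by (rule finite_subset[of _ "total_value I ` Pow S"]) auto

lemma total_value_le_best_value:
  "finite S \<Longrightarrow> B \<subseteq> S \<Longrightarrow> total_size I B \<le> 1 \<Longrightarrow> total_value I B \<le> best_value I S"
  unfolding best_value_def by (intro Max_ge finite_feasible_values) auto

lemma best_value_le:
  assumes "finite S"
    and "\<And>B. B \<subseteq> S \<Longrightarrow> total_size I B \<le> 1 \<Longrightarrow> total_value I B \<le> x"
  shows "best_value I S \<le> x"
proof -
  \<comment> \<open>The empty packing is always feasible, so the maximum is taken over a nonempty
    set.\<close>
  have "total_value I {} \<in> {total_value I B | B. B \<subseteq> S \<and> total_size I B \<le> 1}"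
    by (intro CollectI exI[of _ "{}"]) (simp add: total_size_def)
  then show ?thesis
    unfolding best_value_def using assms by (subst Max_le_iff) (auto simp: finite_feasible_values)
qed

lemma best_value_nonneg: "finite S \<Longrightarrow> 0 \<le> best_value I S"
  using total_value_le_best_value[of S "{}" I] by (simp add: total_size_def total_value_def)

section \<open>A single greedy round\<close>

lemma greedy_fill_superset: "B \<subseteq> greedy_fill R I is B"
proof (induction "is" arbitrary: B)
  case (Cons i "is")
  show ?case using Cons.IH[of "insert i B"] Cons.IH[of B] by auto
qed simp

lemma greedy_fill_size:
  assumes "finite B" "total_size I B \<le> R" "distinct is" "set is \<inter> B = {}"
  shows "total_size I (greedy_fill R I is B) \<le> R"
  using assms
proof (induction "is" arbitrary: B)
  case (Cons i "is")
  then show ?case by (auto simp: total_size_def add.commute)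
qed simp

text \<open>When \<open>j\<close> comes up, everything packed so far is at least as dense as
  \<open>j\<close> and leaves no room for it; packed items are never taken out later in the round.
  The fourth assumption carries the density order over to the accumulator \<open>B\<close>.\<close>

lemma greedy_fill_rejected:
  assumes "valid_input I" "set is \<union> B \<subseteq> {..<length I}"
    and "sorted_wrt (\<lambda>i j. density (I ! i) \<ge> density (I ! j)) is"
    and "\<And>i j. i \<in> B \<Longrightarrow> j \<in> set is \<Longrightarrow> density (I ! j) \<le> density (I ! i)"
    and "j \<in> set is" "j \<notin> greedy_fill R I is B"
  shows "R < total_size I (denser I (density (I ! j)) (greedy_fill R I is B)) + item_size (I ! j)"
  using assms
proof (induction "is" arbitrary: B)
  case (Cons i "is")
  define C where "C = (if total_size I B + item_size (I ! i) \<le> R then insert i B else B)"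
  have fill: "greedy_fill R I (i # is) B = greedy_fill R I is C"
    by (simp add: C_def)
  show ?case
  proof (cases "j \<in> set is")
    case True
    show ?thesis unfolding fill
    proof (rule Cons.IH)
      show "j \<notin> greedy_fill R I is C" using Cons.prems(6) fill by simp
      \<comment> \<open>If \<open>i\<close> has just been packed, sortedness makes it at least as
        dense as all candidates still to come.\<close>
      show "density (I ! l) \<le> density (I ! k)" if "k \<in> C" "l \<in> set is" for k l
        using that Cons.prems(3,4) by (auto simp: C_def split: if_splits)
    qed (use Cons.prems True in \<open>auto simp: C_def\<close>)
  next
    case False
    then have j: "j = i" using Cons.prems(5) by simp
    have "i \<notin> C" using Cons.prems(6) fill j greedy_fill_superset by blast
    then have overflow: "R < total_size I B + item_size (I ! i)" and "C = B"
      by (auto simp: C_def split: if_splits)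
    have "B \<subseteq> denser I (density (I ! j)) (greedy_fill R I is C)"
      using Cons.prems(4,5) greedy_fill_superset[of B R I "is"] \<open>C = B\<close> by (auto simp: denser_def)
    moreover have "greedy_fill R I is C \<subseteq> {..<length I}"
      using greedy_fill_subset[of R I "is" C] Cons.prems(2) \<open>C = B\<close> by auto
    ultimately have "total_size I B \<le> total_size I (denser I (density (I ! j)) (greedy_fill R I is C))"
      by (intro total_size_mono Cons.prems(1)) (auto simp: denser_def)
    then show ?thesis using overflow j fill by simp
  qed
qed simp

lemma greedy_outcome_subset: "greedy_outcome R I S B \<Longrightarrow> B \<subseteq> S"
  unfolding greedy_outcome_def using greedy_fill_subset[of R I _ "{}"] by auto

lemma greedy_outcome_size: "greedy_outcome R I S B \<Longrightarrow> 0 \<le> R \<Longrightarrow> total_size I B \<le> R"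
  unfolding greedy_outcome_def using greedy_fill_size[of "{}" I R] by (auto simp: total_size_def)

text \<open>Bounding the size of \<open>j\<close> by 1 frees the estimate from the rejected item, so
  that it can be passed on from round to round.\<close>

lemma greedy_outcome_rejected:
  assumes "greedy_outcome R I S B" "valid_input I" "S \<subseteq> {..<length I}" "j \<in> S" "j \<notin> B"
  shows "R - 1 < total_size I (denser I (density (I ! j)) B)"
proof -
  obtain "is" where "set is = S" "B = greedy_fill R I is {}"
    and "sorted_wrt (\<lambda>i j. density (I ! i) \<ge> density (I ! j)) is"
    using assms(1) unfolding greedy_outcome_def by blast
  then have "R < total_size I (denser I (density (I ! j)) B) + item_size (I ! j)"
    using greedy_fill_rejected[of I "is" "{}" j R] assms by auto
  moreover have "item_size (I ! j) \<le> 1"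
    using assms by (auto intro: valid_input_nth)
  ultimately show ?thesis by linarith
qed

section \<open>Invariant over the rounds\<close>

lemma density_greedy_step:
  "density_greedy_algorithm R A \<Longrightarrow> valid_input (I @ [e]) \<Longrightarrow>
    greedy_outcome R (I @ [e]) (insert (length I) (A I)) (A (I @ [e]))"
  by (simp add: density_greedy_algorithm_def)

lemma density_greedy_subset:
  assumes "density_greedy_algorithm R A" "valid_input I"
  shows "A I \<subseteq> {..<length I}"
  using assms(2)
proof (induction I rule: rev_induct)
  case Nil
  then show ?case using assms(1) by (simp add: density_greedy_algorithm_def)
next
  case (snoc e I)
  then have "A I \<subseteq> {..<length I}" by (simp add: valid_input_def)
  then show ?case
    using greedy_outcome_subset[OF density_greedy_step[OF assms(1) snoc.prems]] by auto
qed

text \<open>Induction on the rounds. An item rejected in the current round is covered by the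
  single-round estimate; for an item missing earlier, the old dense items either all survive or one
  of them is itself rejected now.\<close>

lemma density_greedy_rejected:
  assumes "density_greedy_algorithm R A" "valid_input I" "j < length I" "j \<notin> A I"
  shows "R - 1 < total_size I (denser I (density (I ! j)) (A I))"
  using assms(2-)
proof (induction I arbitrary: j rule: rev_induct)
  case (snoc e I)
  let ?I = "I @ [e]" and ?B = "A (I @ [e])"
  have valid: "valid_input I" using snoc.prems(1) by (simp add: valid_input_def)
  have old: "A I \<subseteq> {..<length I}"
    by (rule density_greedy_subset[OF assms(1) valid])
  have new: "?B \<subseteq> {..<length ?I}"
    by (rule density_greedy_subset[OF assms(1) snoc.prems(1)])
  have rejected: "R - 1 < total_size ?I (denser ?I (density (?I ! k)) ?B)"
    if "k \<in> insert (length I) (A I)" "k \<notin> ?B" for k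
    using old that
    by (intro greedy_outcome_rejected[OF density_greedy_step[OF assms(1) snoc.prems(1)] snoc.prems(1)])
      auto
  show ?case
  proof (cases "j \<in> insert (length I) (A I)")
    case True
    then show ?thesis using rejected snoc.prems(3) by blast
  next
    case False
    \<comment> \<open>Here \<open>j\<close> was already missing before this round; \<open>D\<close>
      is the set of dense items that the induction hypothesis provides.\<close>
    define D where "D = denser ?I (density (?I ! j)) (A I)"
    have "j < length I" "j \<notin> A I" using False snoc.prems(2) by auto
    then have D: "R - 1 < total_size ?I D"
    proof -
      have "D = denser I (density (I ! j)) (A I)"
        using \<open>j < length I\<close> old by (simp add: D_def denser_append nth_append_left)
      moreover have "D \<subseteq> {..<length I}" using old by (auto simp: D_def denser_def)
      ultimately show ?thesis
        using snoc.IH[OF valid \<open>j < length I\<close> \<open>j \<notin> A I\<close>] by (simp add: total_size_append)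
    qed
    show ?thesis
    proof (cases "D \<subseteq> ?B")
      case True
      then have "D \<subseteq> denser ?I (density (?I ! j)) ?B" by (auto simp: D_def denser_def)
      then have "total_size ?I D \<le> total_size ?I (denser ?I (density (?I ! j)) ?B)"
        using new by (intro total_size_mono snoc.prems(1)) (auto simp: denser_def)
      with D show ?thesis by linarith
    next
      case False
      then obtain k where k: "k \<in> D" "k \<notin> ?B" by blast
      then have "R - 1 < total_size ?I (denser ?I (density (?I ! k)) ?B)"
        by (intro rejected) (auto simp: D_def denser_def)
      \<comment> \<open>As a member of \<open>D\<close>, \<open>k\<close> is at least as dense as
        \<open>j\<close>, so its threshold selects a subset of what the threshold of
        \<open>j\<close> selects.\<close>
      also have "\<dots> \<le> total_size ?I (denser ?I (density (?I ! j)) ?B)"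
        using new k by (intro total_size_mono snoc.prems(1)) (auto simp: D_def denser_def)
      finally show ?thesis .
    qed
  qed
qed simp

section \<open>Upper bounds on the optimum\<close>

text \<open>
  Weak duality for the fractional knapsack problem, with \<open>d\<close> as the dual price of capacity.
\<close>

lemma fractional_bound:
  assumes "valid_input I" "T \<subseteq> {..<length I}" "C \<subseteq> {..<length I}"
    and "\<And>i. i \<in> T \<Longrightarrow> d \<le> density (I ! i)"
    and "\<And>i. i < length I \<Longrightarrow> i \<notin> T \<Longrightarrow> density (I ! i) \<le> d"
  shows "total_value I C \<le> total_value I T + d * (total_size I C - total_size I T)"
proof -
  \<comment> \<open>What an item is worth after paying \<open>d\<close> per unit of size:
    nonnegative on \<open>T\<close> and nonpositive elsewhere, so no set collects more of it than
    \<open>T\<close>.\<close>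
  define g where "g i = item_value (I ! i) - d * item_size (I ! i)" for i
  have g: "(\<Sum>i\<in>X. g i) = total_value I X - d * total_size I X" for X
    by (simp add: g_def total_value_def total_size_def sum_subtractf sum_distrib_left)
  have fin: "finite T" "finite C" using assms(2,3) by (auto intro: finite_subset)
  have "0 \<le> g i" if "i \<in> T" for i
    using that assms(2) assms(4)[of i] valid_input_nth[OF assms(1), of i]
    by (auto simp: g_def density_def field_simps)
  moreover have "g i \<le> 0" if "i \<in> C - T" for i
    using that assms(3) assms(5)[of i] valid_input_nth[OF assms(1), of i]
    by (auto simp: g_def density_def field_simps)
  ultimately have "(\<Sum>i\<in>C \<inter> T. g i) \<le> (\<Sum>i\<in>T. g i)" "(\<Sum>i\<in>C - T. g i) \<le> 0"
    using fin by (auto intro: sum_mono2 sum_nonpos)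
  moreover have "(\<Sum>i\<in>C. g i) = (\<Sum>i\<in>C \<inter> T. g i) + (\<Sum>i\<in>C - T. g i)"
    using fin by (simp add: sum.Int_Diff)
  ultimately show ?thesis by (simp add: g algebra_simps)
qed

text \<open>Besides \<open>T\<close>, of size s, a packing gains at most d(1 - s), and d is at most
  the average density v(T)/s of \<open>T\<close>; together this gives v(T)/s. The product form
  avoids dividing by a possibly zero size.\<close>

lemma value_bound_fitting:
  assumes "valid_input I" "T \<subseteq> {..<length I}" "C \<subseteq> {..<length I}" "0 \<le> d"
    and "\<And>i. i \<in> T \<Longrightarrow> d \<le> density (I ! i)"
    and "\<And>i. i < length I \<Longrightarrow> i \<notin> T \<Longrightarrow> density (I ! i) \<le> d"
    and "total_size I C \<le> 1" "total_size I T \<le> 1"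
  shows "total_size I T * total_value I C \<le> total_value I T"
proof -
  define s where "s = total_size I T"
  have s: "0 \<le> s" "s \<le> 1"
    using assms(8) total_size_mono[OF assms(1) empty_subsetI assms(2)]
    by (auto simp: s_def total_size_def)
  \<comment> \<open>Comparing \<open>T\<close> with the empty packing yields \<open>d * s\<close> as
    a lower bound on the value of \<open>T\<close>.\<close>
  have "total_value I {} \<le> total_value I T + d * (total_size I {} - total_size I T)"
    using assms by (intro fractional_bound) auto
  then have T: "d * s \<le> total_value I T"
    by (simp add: s_def total_value_def[of I "{}"] total_size_def[of I "{}"])
  have "total_value I C \<le> total_value I T + d * (total_size I C - s)"
    unfolding s_def using assms by (intro fractional_bound) auto
  also have "\<dots> \<le> total_value I T + d * (1 - s)"
    using assms(4,7) by (intro add_left_mono mult_left_mono) auto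
  finally have "s * total_value I C \<le> s * (total_value I T + d * (1 - s))"
    using s by (intro mult_left_mono)
  also have "\<dots> = s * total_value I T + (1 - s) * (d * s)" by (simp add: algebra_simps)
  also have "\<dots> \<le> s * total_value I T + (1 - s) * total_value I T"
    using s T by (intro add_left_mono mult_left_mono) auto
  finally show ?thesis by (simp add: s_def algebra_simps)
qed

text \<open>Remove least dense items from \<open>T\<close> until dropping one more would make it
  fit. Then \<open>T\<close> is worth at least as much as \<open>C\<close> and splits into that one
  item and a fitting rest. \<open>S\<close> stays fixed while \<open>T\<close> and \<open>d\<close>
  vary.\<close>

lemma value_bound_overflowing:
  assumes "valid_input I" "T \<subseteq> S" "S \<subseteq> {..<length I}" "C \<subseteq> {..<length I}" "0 \<le> d"
    and "\<And>i. i \<in> T \<Longrightarrow> d \<le> density (I ! i)"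
    and "\<And>i. i < length I \<Longrightarrow> i \<notin> T \<Longrightarrow> density (I ! i) \<le> d"
    and "total_size I C \<le> 1" "1 < total_size I T"
  shows "total_value I C \<le> 2 * best_value I S"
  using assms
proof (induction "card T" arbitrary: T d)
  case 0
  then have "finite T" by (meson finite_lessThan finite_subset)
  then show ?case using 0 by (simp add: total_size_def)
next
  case (Suc n)
  have fin: "finite S" "finite T" using Suc.prems(2,3) by (meson finite_lessThan finite_subset)+
  have "T \<noteq> {}" using Suc.prems(9) by (auto simp: total_size_def)
  then obtain x where x: "x \<in> T" "\<And>i. i \<in> T \<Longrightarrow> density (I ! x) \<le> density (I ! i)"
    using Min_in[of "(\<lambda>i. density (I ! i)) ` T"] Min_le[of "(\<lambda>i. density (I ! i)) ` T"] fin(2)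
    by (fastforce simp del: Min_le)
  have dx: "d \<le> density (I ! x)" using Suc.prems(6) x(1) by blast
  show ?case
  proof (cases "total_size I (T - {x}) \<le> 1")
    case True
    have "total_value I C \<le> total_value I T + d * (total_size I C - total_size I T)"
      using Suc.prems by (intro fractional_bound) auto
    \<comment> \<open>\<open>C\<close> is smaller than \<open>T\<close> in size, so the term with
      the price \<open>d\<close> is nonpositive.\<close>
    also have "\<dots> \<le> total_value I T"
      using Suc.prems by (simp add: mult_nonneg_nonpos)
    also have "\<dots> = total_value I {x} + total_value I (T - {x})"
      using fin(2) x(1) by (simp add: total_value_def sum.remove)
    also have "\<dots> \<le> best_value I S + best_value I S"
    proof (intro add_mono total_value_le_best_value fin True)
      show "total_size I {x} \<le> 1"
        using x(1) Suc.prems(1-3) by (auto simp: total_size_def intro: valid_input_nth)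
    qed (use x(1) Suc.prems(2) in auto)
    finally show ?thesis by simp
  next
    case False
    show ?thesis
    \<comment> \<open>Raising the price to the density of \<open>x\<close> keeps it a threshold once
      \<open>x\<close> has moved outside.\<close>
    proof (rule Suc.hyps(1)[of "T - {x}" "density (I ! x)"])
      show "n = card (T - {x})" using Suc.hyps(2) x(1) fin(2) by simp
      show "density (I ! i) \<le> density (I ! x)" if "i < length I" "i \<notin> T - {x}" for i
        using Suc.prems(7)[of i] that dx by (cases "i = x") auto
      show "0 \<le> density (I ! x)" using dx Suc.prems(5) by linarith
    qed (use Suc.prems x False in auto)
  qed
qed

section \<open>The competitive ratio\<close>

lemma density_greedy_competitive:
  assumes R: "1 < R" "R < 2" and A: "density_greedy_algorithm R A"
  shows "competitive (max (1 / (R - 1)) 2) A"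
  unfolding competitive_def
proof (intro allI impI)
  fix I assume valid: "valid_input I"
  define B where "B = A I"
  have B: "B \<subseteq> {..<length I}"
    unfolding B_def by (rule density_greedy_subset[OF A valid])
  then have finB: "finite B" by (rule finite_subset) simp
  note nonneg = best_value_nonneg[OF finB, of I]
  define rej where "rej = {..<length I} - B"
  have "total_value I C \<le> max (1 / (R - 1)) 2 * best_value I B"
    if C: "C \<subseteq> {..<length I}" "total_size I C \<le> 1" for C
  proof (cases "rej = {}")
    case True
    \<comment> \<open>The buffer still holds every item, so \<open>C\<close> is one of its own
      packings.\<close>
    then have "total_value I C \<le> 1 * best_value I B"
      using C finB by (auto simp: rej_def intro!: total_value_le_best_value)
    also have "\<dots> \<le> max (1 / (R - 1)) 2 * best_value I B"
      using nonneg by (intro mult_right_mono) auto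
    finally show ?thesis .
  next
    case False
    have fin: "finite rej" by (simp add: rej_def)
    then obtain j where j: "j \<in> rej" "\<And>i. i \<in> rej \<Longrightarrow> density (I ! i) \<le> density (I ! j)"
      using Max_in[of "(\<lambda>i. density (I ! i)) ` rej"] Max_ge[of "(\<lambda>i. density (I ! i)) ` rej"] False
      by (fastforce simp del: Max_ge)
    define d where "d = density (I ! j)"
    define T where "T = denser I d B"
    have d: "0 \<le> d"
      using j(1) valid_input_nth[OF valid, of j] by (auto simp: d_def density_def rej_def)
    have T: "T \<subseteq> B" "\<And>i. i \<in> T \<Longrightarrow> d \<le> density (I ! i)"
      by (auto simp: T_def denser_def)
    \<comment> \<open>Items missing from the buffer obey this by maximality of \<open>j\<close>,
      buffer items by the definition of \<open>T\<close>.\<close>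
    have outside: "density (I ! i) \<le> d" if "i < length I" "i \<notin> T" for i
      using that j(2)[of i] by (cases "i \<in> B") (auto simp: T_def denser_def rej_def d_def)
    have size: "R - 1 < total_size I T"
      using density_greedy_rejected[OF A valid, of j] j(1)
      by (simp add: T_def d_def B_def rej_def)
    show ?thesis
    proof (cases "total_size I T \<le> 1")
      case True
      have "0 \<le> total_value I C"
        using C(1) valid unfolding total_value_def by (intro sum_nonneg) (auto intro: valid_input_nth)
      then have "(R - 1) * total_value I C \<le> total_size I T * total_value I C"
        using size by (intro mult_right_mono) auto
      also have "\<dots> \<le> total_value I T"
        using valid T B C d outside True by (intro value_bound_fitting) auto
      also have "\<dots> \<le> best_value I B"
        using finB T(1) True by (rule total_value_le_best_value)
      finally have "total_value I C \<le> 1 / (R - 1) * best_value I B"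
        using R by (simp add: field_simps)
      also have "\<dots> \<le> max (1 / (R - 1)) 2 * best_value I B"
        using nonneg by (intro mult_right_mono) auto
      finally show ?thesis .
    next
      case False
      have "total_value I C \<le> 2 * best_value I B"
        using valid T B C d outside False
        by (intro value_bound_overflowing[where T = T and d = d]) auto
      also have "\<dots> \<le> max (1 / (R - 1)) 2 * best_value I B"
        using nonneg by (intro mult_right_mono) auto
      finally show ?thesis .
    qed
  qed
  then show "OPT I \<le> max (1 / (R - 1)) 2 * ALG A I"
    unfolding OPT_def ALG_def B_def by (intro best_value_le) auto
qed

theorem theorem9:
  fixes R :: real and A :: algorithm
  assumes "1 < R" and "R < 2"
    and "density_greedy_algorithm R A"
  shows "removable_online_algorithm R A \<and> competitive (max (1 / (R - 1)) 2) A"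
proof
  show "removable_online_algorithm R A"
    unfolding removable_online_algorithm_def
  proof (intro conjI allI impI)
    show "A [] = {}" using assms(3) by (simp add: density_greedy_algorithm_def)
    fix I e assume "valid_input (I @ [e])"
    note step = density_greedy_step[OF assms(3) this]
    show "A (I @ [e]) \<subseteq> insert (length I) (A I)"
      using step by (rule greedy_outcome_subset)
    show "total_size (I @ [e]) (A (I @ [e])) \<le> R"
      using step assms(1) by (intro greedy_outcome_size) auto
  qed
  show "competitive (max (1 / (R - 1)) 2) A"
    using assms by (rule density_greedy_competitive)
qed

end
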